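(* Let $b\ge 2$ be an integer and let $\mathcal{M}$ denote Lebesgue measure. There exist constants $A,\lambda>0$ such that $$\left|\mathcal{M}(D_n(k,\ell))-\frac{\log\frac{(\ell b^k+1)((\ell+1)b^{k+1}+1)}{(\ell b^{k+1}+1)((\ell+1)b^k+1)}}{\log\frac{2b}{b+1}}\right|<\frac{Ae^{-\lambda\sqrt{n-1}}}{\ell(\ell+1)b^k}$$ for all $k\in\mathbb{Z}_{\ge 0}$, $\ell\in\{1,2,\dots,b-1\}$ and all integers $n\ge 1$.
   Context: Fix an integer base $b\ge 2$. For real $\alpha\ge 1$, the type III base $b$ continued logarithm for $\alpha$ is defined by the recursion $y_0=\alpha$, and for $n\ge 0$: $a_n=\lfloor \log_b y_n\rfloor$, $c_n=\lfloor y_n/b^{a_n}\rfloor$; if $y_n=c_nb^{a_n}$ the process terminates; otherwise $y_{n+1}=\dfrac{b^{a_n}}{y_n-c_nb^{a_n}}$. (Thus $a_n\in\mathbb{Z}_{\ge 0}$, $c_n\in\{1,\dots,b-1\}$.) The process is infinite for irrational $\alpha$; the sets below are considered up to the null set of rational $\alpha$. For $n\ge 1$, $k\in\mathbb{Z}_{\ge 0}$, $\ell\in\{1,\dots,b-1\}$, let $D_n(k,\ell)=\{\alpha\in(1,2): a_n=k,\ c_n=\ell\}$. *)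

theory Defs
  imports "HOL-Analysis.Analysis"
begin

definition clog_exponent :: "nat \<Rightarrow> real \<Rightarrow> int" where
  "clog_exponent b y = \<lfloor>log (real b) y\<rfloor>"

definition clog_coeff :: "nat \<Rightarrow> real \<Rightarrow> int" where
  "clog_coeff b y = \<lfloor>y / real b powi clog_exponent b y\<rfloor>"

text \<open>
  The complete quotients \<open>y\<^sub>n\<close> of \<open>\<alpha>\<close>. The value is \<open>None\<close> when the process has terminated at
  some stage before \<open>n\<close>; at the terminating stage itself \<open>y\<^sub>n\<close>, \<open>a\<^sub>n\<close> and \<open>c\<^sub>n\<close> are still defined.
\<close>
primrec clog_quotient :: "nat \<Rightarrow> real \<Rightarrow> nat \<Rightarrow> real option" where
  "clog_quotient b \<alpha> 0 = Some \<alpha>"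
| "clog_quotient b \<alpha> (Suc n) =
    (case clog_quotient b \<alpha> n of
       None \<Rightarrow> None
     | Some y \<Rightarrow>
        (let p = real b powi clog_exponent b y;
             r = y - of_int (clog_coeff b y) * p
         in if r = 0 then None else Some (p / r)))"

definition clog_a :: "nat \<Rightarrow> real \<Rightarrow> nat \<Rightarrow> int option" where
  "clog_a b \<alpha> n = map_option (clog_exponent b) (clog_quotient b \<alpha> n)"

definition clog_c :: "nat \<Rightarrow> real \<Rightarrow> nat \<Rightarrow> int option" where
  "clog_c b \<alpha> n = map_option (clog_coeff b) (clog_quotient b \<alpha> n)"

definition clog_D :: "nat \<Rightarrow> nat \<Rightarrow> nat \<Rightarrow> nat \<Rightarrow> real set" where
  "clog_D b n k l =
    {\<alpha> \<in> {1<..<2}. clog_a b \<alpha> n = Some (int k) \<and> clog_c b \<alpha> n = Some (int l)}"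

end

theory Submission
  imports Defs
begin

text \<open>
  The points \<open>x\<^sub>n = 1 / y\<^sub>n\<close> with \<open>n \<ge> 1\<close> are the orbit of \<open>\<alpha> - 1\<close> under an interval map with the full
  inverse branches \<open>s \<mapsto> 1 / ((c + s) * b ^ a)\<close>, so the densities of their distributions are iterates
  of the transfer operator on the constant \<open>1\<close>. This operator maps a cone of densities with bounded
  logarithmic derivative into a narrower one, which leaves room to subtract a fixed fraction of the
  invariant density from the remainder at each step. Hence the remainder stays in the cone while its
  mass, and with it its supremum, decays geometrically; this is stronger than the rate claimed.
  Working with distribution functions and the mean value theorem avoids integration.
\<close>

section \<open>Digits and the sets of prescribed quotients\<close>

text \<open>As \<open>1 \<le> c\<close> and \<open>c + 1 \<le> b\<close>, the cell
  \<open>[c * b ^ a, (c + 1) * b ^ a)\<close> lies inside \<open>[b ^ a, b ^ Suc a)\<close>, which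
  fixes both floors. Together with \<open>clog_digits_exist\<close> this says that the cells tile
  \<open>[1, \<infinity>)\<close>, so that digits can be handled through inequalities.\<close>

lemma clog_digits_unique:
  fixes y :: real
  assumes "b \<ge> 2" "c \<in> {1..<b}" "real c * real b ^ a \<le> y" "y < (real c + 1) * real b ^ a"
  shows "clog_exponent b y = int a" "clog_coeff b y = int c"
proof -
  have b: "real b > 1" and c: "1 \<le> real c" "real c + 1 \<le> real b"
    using assms(1,2) by auto
  have pos: "real b ^ a > 0" using b by simp
  have "1 * real b ^ a \<le> real c * real b ^ a"
    by (rule mult_right_mono) (use c pos in auto)
  hence lo: "real b ^ a \<le> y" using assms(3) by linarith
  have "(real c + 1) * real b ^ a \<le> real b * real b ^ a"
    by (rule mult_right_mono) (use c pos in auto)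
  hence hi: "y < real b ^ Suc a" using assms(4) by simp
  have y: "y > 0" using lo pos by linarith
  have "log (real b) y \<ge> real a"
    using lo b y by (simp add: le_log_iff powr_realpow)
  moreover have "log (real b) y < real (Suc a)"
  proof -
    have "y < real b powr real (Suc a)" using hi b by (simp only: powr_realpow)
    thus ?thesis using b y by (subst log_less_iff) auto
  qed
  ultimately show e: "clog_exponent b y = int a"
    unfolding clog_exponent_def by (intro floor_unique) auto
  show "clog_coeff b y = int c"
    unfolding clog_coeff_def e
    by (intro floor_unique) (use assms(3,4) pos in \<open>auto simp: field_simps\<close>)
qed

lemma clog_digits_exist:
  fixes y :: real
  assumes "b \<ge> 2" "y \<ge> 1"
  obtains a c where "c \<in> {1..<b}" "real c * real b ^ a \<le> y" "y < (real c + 1) * real b ^ a"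
proof -
  have b: "real b > 1" using assms(1) by simp
  have l0: "log (real b) y \<ge> 0" using b assms(2) by simp
  define a where "a = nat \<lfloor>log (real b) y\<rfloor>"
  have a1: "real a \<le> log (real b) y" "log (real b) y < real (Suc a)"
    unfolding a_def using l0 by linarith+
  have lo: "real b ^ a \<le> y"
    using a1(1) b assms(2) by (simp add: le_log_iff powr_realpow)
  have "y < real b powr real (Suc a)"
    using a1(2) b assms(2) by (subst (asm) log_less_iff) auto
  hence hi: "y < real b ^ Suc a" using b by (simp only: powr_realpow)
  have pos: "real b ^ a > 0" using b by simp
  define c where "c = nat \<lfloor>y / real b ^ a\<rfloor>"
  have q: "1 \<le> y / real b ^ a" "y / real b ^ a < real b"
    using lo hi pos by (auto simp: field_simps)
  have c: "real c \<le> y / real b ^ a" "y / real b ^ a < real c + 1"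
    unfolding c_def using q by linarith+
  have "real c < real b" "0 < real c" using c q by linarith+
  hence "c \<in> {1..<b}" by auto
  thus ?thesis
    by (rule that[of c a]) (use c pos in \<open>auto simp: field_simps\<close>)
qed

text \<open>When the process continues from \<open>z\<close>, the remainder
  \<open>z - c * b ^ a\<close> lies strictly between \<open>0\<close> and
  \<open>b ^ a\<close>.\<close>

lemma clog_quotient_gt_1:
  assumes "b \<ge> 2" "\<alpha> > 1" "clog_quotient b \<alpha> n = Some y"
  shows "y > 1"
  using assms(3)
proof (induction n arbitrary: y)
  case 0
  then show ?case using assms(2) by simp
next
  case (Suc n)
  obtain z where z: "clog_quotient b \<alpha> n = Some z"
    using Suc.prems by (auto split: option.splits)
  have "z \<ge> 1" using Suc.IH[OF z] by simp
  then obtain a c where ac: "c \<in> {1..<b}" "real c * real b ^ a \<le> z" "z < (real c + 1) * real b ^ a"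
    using clog_digits_exist[OF assms(1)] by blast
  note d = clog_digits_unique[OF assms(1) ac]
  have y: "z - real c * real b ^ a \<noteq> 0" "y = real b ^ a / (z - real c * real b ^ a)"
    using Suc.prems z d by (auto simp: Let_def split: if_splits)
  show ?case unfolding y(2) using y(1) ac(2,3) by (auto simp: field_simps)
qed

lemma clog_quotient_Suc_iff:
  assumes "b \<ge> 2" "c \<in> {1..<b}" "real c * real b ^ a \<le> z" "z < (real c + 1) * real b ^ a"
    "clog_quotient b \<alpha> n = Some z"
  shows "clog_quotient b \<alpha> (Suc n) = Some y \<longleftrightarrow>
    z \<noteq> real c * real b ^ a \<and> y = real b ^ a / (z - real c * real b ^ a)"
  using clog_digits_unique[OF assms(1-4)] assms(5) by (auto simp: Let_def)

text \<open>The condition \<open>1 < s * y\<close> says \<open>1 / y < s\<close>, but is also correct for \<open>s = 0\<close>.\<close>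

definition clog_tail :: "nat \<Rightarrow> nat \<Rightarrow> real \<Rightarrow> real set" where
  "clog_tail b n s = {\<alpha> \<in> {1<..<2}. \<exists>y. clog_quotient b \<alpha> n = Some y \<and> 1 < s * y}"

definition clog_fibre :: "nat \<Rightarrow> nat \<Rightarrow> real \<Rightarrow> real set" where
  "clog_fibre b n z = {\<alpha> \<in> {1<..<2}. clog_quotient b \<alpha> n = Some z}"

definition clog_between :: "nat \<Rightarrow> nat \<Rightarrow> real \<Rightarrow> real \<Rightarrow> real set" where
  "clog_between b n u v = {\<alpha> \<in> {1<..<2}. \<exists>y. clog_quotient b \<alpha> n = Some y \<and> u < y \<and> y < v}"

text \<open>A step of the process is inverted by the countably many branches
  \<open>b ^ a * (c + 1 / z)\<close>, so \<open>z\<close> has only countably many ancestors at stage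
  \<open>0\<close>. The fibres are therefore null, and boundary points of cells do not affect
  measures.\<close>

lemma countable_clog_fibre:
  assumes "b \<ge> 2"
  shows "countable (clog_fibre b n z)"
proof (induction n arbitrary: z)
  case 0
  have "clog_fibre b 0 z \<subseteq> {z}" by (auto simp: clog_fibre_def)
  then show ?case by (rule countable_subset) simp
next
  case (Suc n)
  have "clog_fibre b (Suc n) z \<subseteq>
      (\<Union>a. \<Union>c\<in>{1..<b}. clog_fibre b n (real b ^ a * (real c + 1 / z)))"
  proof
    fix \<alpha> assume A: "\<alpha> \<in> clog_fibre b (Suc n) z"
    hence al: "\<alpha> \<in> {1<..<2}" and q: "clog_quotient b \<alpha> (Suc n) = Some z"
      by (auto simp: clog_fibre_def)
    from q obtain w where w: "clog_quotient b \<alpha> n = Some w" by (auto split: option.splits)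
    have w1: "w \<ge> 1" using clog_quotient_gt_1[OF assms _ w] al by simp
    obtain a c where ac: "c \<in> {1..<b}" "real c * real b ^ a \<le> w" "w < (real c + 1) * real b ^ a"
      using clog_digits_exist[OF assms w1] .
    have z: "w \<noteq> real c * real b ^ a" "z = real b ^ a / (w - real c * real b ^ a)"
      using clog_quotient_Suc_iff[OF assms ac w] q by auto
    have "1 / z = (w - real c * real b ^ a) / real b ^ a" unfolding z(2) by simp
    hence "w = real b ^ a * (real c + 1 / z)" using assms by (simp add: field_simps)
    thus "\<alpha> \<in> (\<Union>a. \<Union>c\<in>{1..<b}. clog_fibre b n (real b ^ a * (real c + 1 / z)))"
      using ac(1) w al by (intro UN_I[of a] UN_I[of c]) (auto simp: clog_fibre_def)
  qed
  then show ?case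
    by (rule countable_subset) (auto intro!: countable_UN Suc.IH)
qed

lemma negligible_clog_fibre: "b \<ge> 2 \<Longrightarrow> clog_fibre b n z \<in> null_sets lebesgue"
  by (intro null_sets_completionI countable_imp_null_set_lborel countable_clog_fibre)

text \<open>If the quotient \<open>w\<close> at stage \<open>n\<close> has digits \<open>a\<close>
  and \<open>c\<close>, the condition on the next quotient unfolds to
  \<open>w < (c + s) * b ^ a\<close>. The lower bound on \<open>w\<close> is strict because the
  process stops at \<open>w = c * b ^ a\<close>.\<close>

lemma clog_tail_Suc:
  assumes "b \<ge> 2" "0 \<le> s" "s \<le> 1"
  shows "clog_tail b (Suc n) s =
    (\<Union>a. \<Union>c\<in>{1..<b}. clog_between b n (real c * real b ^ a) ((real c + s) * real b ^ a))"
proof (intro equalityI subsetI)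
  fix \<alpha> assume "\<alpha> \<in> clog_tail b (Suc n) s"
  then obtain y where al: "\<alpha> \<in> {1<..<2}" and q: "clog_quotient b \<alpha> (Suc n) = Some y" and y: "1 < s * y"
    by (auto simp: clog_tail_def)
  from q obtain w where w: "clog_quotient b \<alpha> n = Some w" by (auto split: option.splits)
  have w1: "w \<ge> 1" using clog_quotient_gt_1[OF assms(1) _ w] al by simp
  obtain a c where ac: "c \<in> {1..<b}" "real c * real b ^ a \<le> w" "w < (real c + 1) * real b ^ a"
    using clog_digits_exist[OF assms(1) w1] .
  have z: "w \<noteq> real c * real b ^ a" "y = real b ^ a / (w - real c * real b ^ a)"
    using clog_quotient_Suc_iff[OF assms(1) ac w] q by auto
  have pos: "w - real c * real b ^ a > 0" using z ac by auto
  have "w < (real c + s) * real b ^ a"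
    using y pos unfolding z(2) by (simp add: field_simps)
  thus "\<alpha> \<in> (\<Union>a. \<Union>c\<in>{1..<b}. clog_between b n (real c * real b ^ a) ((real c + s) * real b ^ a))"
    using ac(1) w al pos by (intro UN_I[of a] UN_I[of c]) (auto simp: clog_between_def)
next
  fix \<alpha> assume "\<alpha> \<in> (\<Union>a. \<Union>c\<in>{1..<b}. clog_between b n (real c * real b ^ a) ((real c + s) * real b ^ a))"
  then obtain a c w where c: "c \<in> {1..<b}" and al: "\<alpha> \<in> {1<..<2}"
    and w: "clog_quotient b \<alpha> n = Some w"
    and lo: "real c * real b ^ a < w" and hi: "w < (real c + s) * real b ^ a"
    by (auto simp: clog_between_def)
  have "(real c + s) * real b ^ a \<le> (real c + 1) * real b ^ a"
    using assms by (intro mult_right_mono) auto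
  hence hi': "w < (real c + 1) * real b ^ a" using hi by linarith
  have "clog_quotient b \<alpha> (Suc n) = Some (real b ^ a / (w - real c * real b ^ a))"
    using clog_quotient_Suc_iff[OF assms(1) c _ hi' w] lo by auto
  moreover have "1 < s * (real b ^ a / (w - real c * real b ^ a))"
    using lo hi by (simp add: field_simps)
  ultimately show "\<alpha> \<in> clog_tail b (Suc n) s" using al by (auto simp: clog_tail_def)
qed

lemma clog_between_eq_Diff:
  assumes "b \<ge> 2" "0 < u" "u \<le> v"
  shows "clog_between b n u v = clog_tail b n (1/u) - clog_tail b n (1/v) - clog_fibre b n v"
proof -
  have "1 < 1 / u * y \<longleftrightarrow> u < y" "1 < 1 / v * y \<longleftrightarrow> v < y" for y
    using assms by (auto simp: divide_simps)
  thus ?thesis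
    using assms unfolding clog_between_def clog_tail_def clog_fibre_def by auto
qed

lemma clog_tail_mono:
  assumes "b \<ge> 2" "s \<le> t"
  shows "clog_tail b n s \<subseteq> clog_tail b n t"
proof
  fix \<alpha> assume "\<alpha> \<in> clog_tail b n s"
  then obtain y where y: "\<alpha> \<in> {1<..<2}" "clog_quotient b \<alpha> n = Some y" "1 < s * y"
    by (auto simp: clog_tail_def)
  have "y > 1" using clog_quotient_gt_1[OF assms(1) _ y(2)] y(1) by simp
  hence "s * y \<le> t * y" using assms(2) by (intro mult_right_mono) auto
  thus "\<alpha> \<in> clog_tail b n t" using y by (auto simp: clog_tail_def)
qed

section \<open>Measures of the tails and the recursion for their distribution functions\<close>

lemma sets_clog_between:
  assumes "b \<ge> 2" "0 < u" "u \<le> v"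
    and "clog_tail b n (1/u) \<in> sets lebesgue" "clog_tail b n (1/v) \<in> sets lebesgue"
  shows "clog_between b n u v \<in> sets lebesgue"
  unfolding clog_between_eq_Diff[OF assms(1-3)]
  by (intro sets.Diff assms(4,5) null_setsD2 negligible_clog_fibre assms(1))

text \<open>On \<open>(1, 2)\<close> the initial digits are \<open>a = 0\<close> and
  \<open>c = 1\<close>, so the quotient at stage \<open>1\<close> is
  \<open>1 / (\<alpha> - 1)\<close>. The orbit thus starts from the uniform distribution on
  \<open>[0, 1]\<close>.\<close>

lemma clog_tail_1:
  assumes "b \<ge> 2" "0 \<le> s" "s \<le> 1"
  shows "clog_tail b 1 s = {1<..<1 + s}"
proof -
  have q: "clog_quotient b \<alpha> 1 = Some (1 / (\<alpha> - 1))" if "1 < \<alpha>" "\<alpha> < 2" for \<alpha>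
  proof -
    have "clog_quotient b \<alpha> (Suc 0) = Some (1 / (\<alpha> - 1)) \<longleftrightarrow>
      \<alpha> \<noteq> real 1 * real b ^ 0 \<and> 1 / (\<alpha> - 1) = real b ^ 0 / (\<alpha> - real 1 * real b ^ 0)"
      by (rule clog_quotient_Suc_iff) (use that assms(1) in auto)
    thus ?thesis using that by simp
  qed
  have "1 < s * (1 / (\<alpha> - 1)) \<longleftrightarrow> \<alpha> < 1 + s" if "1 < \<alpha>" for \<alpha>
    using that by (auto simp: divide_simps)
  thus ?thesis
    unfolding clog_tail_def using q assms(3) by force
qed

lemma clog_scale_ge_1:
  assumes "b \<ge> 2" "c \<in> {1..<b}" "0 \<le> s"
  shows "1 \<le> (real c + s) * real b ^ a"
proof -
  have "1 * 1 \<le> (real c + s) * real b ^ a"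
    by (rule mult_mono) (use assms in auto)
  thus ?thesis by simp
qed

lemma sets_clog_tail:
  assumes "b \<ge> 2" "0 \<le> s" "s \<le> 1"
  shows "clog_tail b (Suc n) s \<in> sets lebesgue"
  using assms(2,3)
proof (induction n arbitrary: s)
  case 0
  then show ?case using clog_tail_1[OF assms(1) 0] by simp
next
  case (Suc n)
  \<comment> \<open>The points \<open>1 / ((c + t) * b ^ a)\<close> stay in \<open>[0, 1]\<close>,
    so the induction hypothesis covers both ends of every piece in
    \<open>clog_tail_Suc\<close>.\<close>
  have *: "clog_tail b (Suc n) (1 / ((real c + t) * real b ^ a)) \<in> sets lebesgue"
    if "c \<in> {1..<b}" "0 \<le> t" for a c t
    by (rule Suc.IH) (use clog_scale_ge_1[OF assms(1) that, of a] in auto)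
  have "clog_between b (Suc n) (real c * real b ^ a) ((real c + s) * real b ^ a) \<in> sets lebesgue"
    if "c \<in> {1..<b}" for a c
    using *[OF that, of 0 a] *[OF that, of s a] Suc.prems assms clog_scale_ge_1[OF assms(1) that, of 0 a]
    by (intro sets_clog_between) (auto intro!: mult_right_mono)
  then show ?case
    unfolding clog_tail_Suc[OF assms(1) Suc.prems]
    by (intro sets.countable_UN sets.finite_UN) auto
qed

lemma fmeasurable_clog_tail:
  assumes "b \<ge> 2" "0 \<le> s" "s \<le> 1"
  shows "clog_tail b (Suc n) s \<in> lmeasurable"
  by (rule fmeasurableI2[of "{1..2}"])
     (use sets_clog_tail[OF assms] in \<open>auto simp: clog_tail_def\<close>)

text \<open>The distribution function of the reciprocal of the quotient at stage
  \<open>n + 1\<close>. With this shift \<open>clog_dist b 0\<close> is the identity on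
  \<open>[0, 1]\<close>.\<close>

definition clog_dist :: "nat \<Rightarrow> nat \<Rightarrow> real \<Rightarrow> real" where
  "clog_dist b n s = measure lebesgue (clog_tail b (Suc n) s)"

lemma measure_clog_between:
  assumes "b \<ge> 2" "1 \<le> u" "u \<le> v"
  shows "measure lebesgue (clog_between b (Suc n) u v)
    = clog_dist b n (1/u) - clog_dist b n (1/v)"
proof -
  let ?A = "clog_tail b (Suc n) (1/u)" and ?B = "clog_tail b (Suc n) (1/v)"
  have m: "?A \<in> lmeasurable" "?B \<in> lmeasurable"
    using assms by (auto intro!: fmeasurable_clog_tail)
  have sub: "?B \<subseteq> ?A"
    using assms by (intro clog_tail_mono) (auto simp: field_simps)
  have "clog_between b (Suc n) u v = ?A - ?B - clog_fibre b (Suc n) v"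
    using assms by (intro clog_between_eq_Diff) auto
  also have "measure lebesgue \<dots> = measure lebesgue (?A - ?B)"
    using m by (intro measure_Diff_null_set negligible_clog_fibre assms sets.Diff fmeasurableD)
  also have "\<dots> = measure lebesgue ?A - measure lebesgue ?B"
    by (rule measurable_measure_Diff[OF m(1) fmeasurableD[OF m(2)] sub])
  finally show ?thesis unfolding clog_dist_def .
qed

text \<open>The Gauss-Kuzmin recursion, stated for distribution functions instead of densities. The
  pieces in \<open>clog_tail_Suc\<close> are disjoint because a quotient determines its digits, so
  countable additivity applies, with a finite sum over \<open>c\<close> inside a series over
  \<open>a\<close>.\<close>

lemma clog_dist_sums:
  assumes "b \<ge> 2" "0 \<le> s" "s \<le> 1"
  shows "(\<lambda>a. \<Sum>c=1..<b. clog_dist b n (1 / (real c * real b ^ a)) - clog_dist b n (1 / ((real c + s) * real b ^ a)))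
    sums clog_dist b (Suc n) s"
proof -
  define P where "P = (\<lambda>a c. clog_between b (Suc n) (real c * real b ^ a) ((real c + s) * real b ^ a))"
  have sc: "1 \<le> real c * real b ^ a" "real c * real b ^ a \<le> (real c + s) * real b ^ a"
    if "c \<in> {1..<b}" for a c
    using clog_scale_ge_1[OF assms(1) that, of 0 a] assms by (auto intro!: mult_right_mono)
  have P_sets: "P a c \<in> sets lebesgue" if "c \<in> {1..<b}" for a c
  proof -
    have "1 \<le> u \<Longrightarrow> clog_tail b (Suc n) (1 / u) \<in> sets lebesgue" for u
      using assms(1) by (intro sets_clog_tail) auto
    thus ?thesis
      unfolding P_def using sc[OF that, of a] order_trans[OF sc[OF that, of a]] assms(1) by (intro sets_clog_between) auto
  qed
  have P_fm: "P a c \<in> lmeasurable" if "c \<in> {1..<b}" for a c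
    by (rule fmeasurableI2[of "{1..2}"]) (use P_sets[OF that] in \<open>auto simp: P_def clog_between_def\<close>)
  have P_digits: "a = a' \<and> c = c'"
    if "\<alpha> \<in> P a c" "\<alpha> \<in> P a' c'" "c \<in> {1..<b}" "c' \<in> {1..<b}" for \<alpha> a c a' c'
  proof -
    have *: "\<exists>y. clog_quotient b \<alpha> (Suc n) = Some y \<and> clog_exponent b y = int a \<and> clog_coeff b y = int c"
      if "\<alpha> \<in> P a c" "c \<in> {1..<b}" for a c
    proof -
      from that obtain y where y: "clog_quotient b \<alpha> (Suc n) = Some y"
        "real c * real b ^ a < y" "y < (real c + s) * real b ^ a"
        unfolding P_def clog_between_def by blast
      have "(real c + s) * real b ^ a \<le> (real c + 1) * real b ^ a"
        using assms by (intro mult_right_mono) auto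
      hence "y < (real c + 1) * real b ^ a" using y by linarith
      thus ?thesis using clog_digits_unique[OF assms(1) that(2)] y by (meson less_imp_le)
    qed
    show ?thesis using *[OF that(1,3)] *[OF that(2,4)] by auto
  qed
  define U where "U = (\<lambda>a. \<Union>c\<in>{1..<b}. P a c)"
  have U_meas: "measure lebesgue (U a) = (\<Sum>c=1..<b. measure lebesgue (P a c))" for a
    unfolding U_def
  proof (rule measure_finite_Union)
    show "disjoint_family_on (P a) {1..<b}"
      unfolding disjoint_family_on_def using P_digits by blast
    show "P a ` {1..<b} \<subseteq> sets lebesgue" using P_sets by blast
    show "emeasure lebesgue (P a c) \<noteq> \<infinity>" if "c \<in> {1..<b}" for c
      using P_fm[OF that, of a] by (auto simp: fmeasurable_def)
  qed simp
  have T: "clog_tail b (Suc (Suc n)) s = (\<Union>a. U a)"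
    unfolding U_def P_def by (rule clog_tail_Suc[OF assms(1-3)])
  have "(\<lambda>a. measure lebesgue (U a)) sums measure lebesgue (\<Union>a. U a)"
  proof (rule measure_UNION)
    show "range U \<subseteq> sets lebesgue" unfolding U_def using P_sets by auto
    show "disjoint_family U" unfolding disjoint_family_on_def U_def using P_digits by blast
    show "emeasure lebesgue (\<Union>a. U a) \<noteq> \<infinity>"
      using fmeasurable_clog_tail[OF assms(1-3), of "Suc n"] unfolding T[symmetric] fmeasurable_def by auto
  qed
  moreover have "measure lebesgue (P a c) =
      clog_dist b n (1 / (real c * real b ^ a)) - clog_dist b n (1 / ((real c + s) * real b ^ a))"
    if "c \<in> {1..<b}" for a c
    unfolding P_def by (rule measure_clog_between[OF assms(1) sc[OF that]])
  ultimately show ?thesis unfolding clog_dist_def T U_meas by simp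
qed

text \<open>The digits are \<open>k\<close> and \<open>l\<close> exactly when the quotient lies in
  \<open>[u, v)\<close>. The left end \<open>u\<close>, where the process terminates, belongs to the
  set but contributes only a null fibre.\<close>

lemma measure_clog_D:
  assumes "b \<ge> 2" "l \<in> {1..<b}"
  shows "measure lebesgue (clog_D b (Suc n) k l)
    = clog_dist b n (1 / (real l * real b ^ k)) - clog_dist b n (1 / ((real l + 1) * real b ^ k))"
proof -
  define u v where "u = real l * real b ^ k" and "v = (real l + 1) * real b ^ k"
  have "real b ^ k > 0" using assms(1) by simp
  hence uv: "1 \<le> u" "u < v"
    using clog_scale_ge_1[OF assms, of 0 k] by (auto simp: u_def v_def)
  have "clog_D b (Suc n) k l = clog_between b (Suc n) u v \<union> clog_fibre b (Suc n) u"
  proof (rule set_eqI)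
    fix \<alpha>
    have "clog_exponent b y = int k \<and> clog_coeff b y = int l \<longleftrightarrow> u \<le> y \<and> y < v"
      if \<alpha>: "1 < \<alpha>" and y: "clog_quotient b \<alpha> (Suc n) = Some y" for y
    proof
      assume d: "clog_exponent b y = int k \<and> clog_coeff b y = int l"
      have "y \<ge> 1" using clog_quotient_gt_1[OF assms(1) \<alpha> y] by simp
      then obtain a c where ac: "c \<in> {1..<b}" "real c * real b ^ a \<le> y" "y < (real c + 1) * real b ^ a"
        using clog_digits_exist[OF assms(1)] by blast
      have "a = k" "c = l" using clog_digits_unique[OF assms(1) ac] d by simp_all
      thus "u \<le> y \<and> y < v" using ac unfolding u_def v_def by blast
    next
      assume "u \<le> y \<and> y < v"
      thus "clog_exponent b y = int k \<and> clog_coeff b y = int l"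
        using clog_digits_unique[OF assms] unfolding u_def v_def by blast
    qed
    moreover have "u \<le> y \<and> y < v \<longleftrightarrow> u < y \<and> y < v \<or> y = u" for y
      using uv(2) by linarith
    ultimately show "\<alpha> \<in> clog_D b (Suc n) k l \<longleftrightarrow>
      \<alpha> \<in> clog_between b (Suc n) u v \<union> clog_fibre b (Suc n) u"
      unfolding clog_D_def clog_a_def clog_c_def clog_between_def clog_fibre_def
      by (cases "clog_quotient b \<alpha> (Suc n)") (auto simp del: clog_quotient.simps)
  qed
  moreover have "clog_between b (Suc n) u v \<in> sets lebesgue"
  proof -
    have "1 \<le> w \<Longrightarrow> clog_tail b (Suc n) (1 / w) \<in> sets lebesgue" for w
      using assms(1) by (intro sets_clog_tail) auto
    thus ?thesis
      using uv assms(1) by (intro sets_clog_between) auto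
  qed
  ultimately have "measure lebesgue (clog_D b (Suc n) k l) = measure lebesgue (clog_between b (Suc n) u v)"
    using measure_Un_null_set[OF _ negligible_clog_fibre[OF assms(1)]] by metis
  also have "\<dots> = clog_dist b n (1 / u) - clog_dist b n (1 / v)"
    using uv by (intro measure_clog_between assms(1)) auto
  finally show ?thesis unfolding u_def v_def .
qed

section \<open>The cone of densities\<close>

text \<open>
  Membership bounds the logarithmic derivative of \<open>g\<close> with respect to the coordinate
  \<open>ln (1 + x)\<close> by \<open>m\<close>. In this coordinate, unlike in \<open>x\<close> itself, all inverse branches
  \<open>s \<mapsto> 1 / ((c + s) * b ^ a)\<close> contract by the factor \<open>1 / 2\<close>.
\<close>

definition gauss_cone :: "nat \<Rightarrow> (real \<Rightarrow> real) \<Rightarrow> bool" where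
  "gauss_cone m g \<longleftrightarrow> (\<forall>x\<in>{0..1}. 0 \<le> g x) \<and>
    (\<forall>x y. 0 \<le> x \<longrightarrow> x \<le> y \<longrightarrow> y \<le> 1 \<longrightarrow>
      g y \<le> ((1 + y) / (1 + x)) ^ m * g x \<and> g x \<le> ((1 + y) / (1 + x)) ^ m * g y)"

lemma gauss_coneI:
  assumes "\<And>x. 0 \<le> x \<Longrightarrow> x \<le> 1 \<Longrightarrow> 0 \<le> g x"
    and "\<And>x y. 0 \<le> x \<Longrightarrow> x \<le> y \<Longrightarrow> y \<le> 1 \<Longrightarrow> g y \<le> ((1 + y) / (1 + x)) ^ m * g x"
    and "\<And>x y. 0 \<le> x \<Longrightarrow> x \<le> y \<Longrightarrow> y \<le> 1 \<Longrightarrow> g x \<le> ((1 + y) / (1 + x)) ^ m * g y"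
  shows "gauss_cone m g"
  using assms unfolding gauss_cone_def by auto

lemma gauss_coneD:
  assumes "gauss_cone m g"
  shows "0 \<le> x \<Longrightarrow> x \<le> 1 \<Longrightarrow> 0 \<le> g x"
    and "0 \<le> x \<Longrightarrow> x \<le> y \<Longrightarrow> y \<le> 1 \<Longrightarrow> g y \<le> ((1 + y) / (1 + x)) ^ m * g x"
    and "0 \<le> x \<Longrightarrow> x \<le> y \<Longrightarrow> y \<le> 1 \<Longrightarrow> g x \<le> ((1 + y) / (1 + x)) ^ m * g y"
  using assms unfolding gauss_cone_def by auto

text \<open>A Harnack inequality: \<open>(1 + y) / (1 + x)\<close> is at most \<open>2\<close> on
  \<open>[0, 1]\<close>. It turns one known value, such as a mean value, into bounds on the whole
  interval.\<close>

lemma gauss_cone_bound: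
  assumes "gauss_cone m g" "x \<in> {0..1}" "y \<in> {0..1}"
  shows "g x \<le> 2 ^ m * g y"
proof -
  have *: "((1 + v) / (1 + u)) ^ m * g z \<le> 2 ^ m * g z"
    if "0 \<le> u" "u \<le> v" "v \<le> 1" "0 \<le> z" "z \<le> 1" for u v z :: real
    by (intro mult_right_mono power_mono gauss_coneD(1)[OF assms(1)]) (use that in \<open>auto simp: field_simps\<close>)
  show ?thesis
  proof (cases "x \<le> y")
    case True
    then show ?thesis
      using gauss_coneD(3)[OF assms(1), of x y] *[of x y y] assms by auto
  next
    case False
    then show ?thesis
      using gauss_coneD(2)[OF assms(1), of y x] *[of y x y] assms by auto
  qed
qed

section \<open>Operations on the cone: sums, inverse branches, subtraction\<close>

lemma gauss_cone_sum:
  assumes "\<And>i. i \<in> I \<Longrightarrow> gauss_cone m (g i)"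
  shows "gauss_cone m (\<lambda>s. \<Sum>i\<in>I. g i s)"
  by (rule gauss_coneI) (auto simp: sum_distrib_left intro!: sum_nonneg sum_mono gauss_coneD[OF assms])

lemma gauss_cone_suminf:
  assumes "\<And>i. gauss_cone m (g i)" "\<And>s. 0 \<le> s \<Longrightarrow> s \<le> 1 \<Longrightarrow> summable (\<lambda>i. g i s)"
  shows "gauss_cone m (\<lambda>s. \<Sum>i. g i s)"
proof (rule gauss_coneI)
  show "0 \<le> (\<Sum>i. g i x)" if "0 \<le> x" "x \<le> 1" for x
    using that assms gauss_coneD(1) by (intro suminf_nonneg) blast+
  show "(\<Sum>i. g i y) \<le> ((1 + y) / (1 + x)) ^ m * (\<Sum>i. g i x)"
    if "0 \<le> x" "x \<le> y" "y \<le> 1" for x y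
    unfolding suminf_mult[OF assms(2)[OF that(1) order_trans[OF that(2,3)]], symmetric]
    by (intro suminf_le gauss_coneD[OF assms(1)] summable_mult assms(2)) (use that in auto)
  show "(\<Sum>i. g i x) \<le> ((1 + y) / (1 + x)) ^ m * (\<Sum>i. g i y)"
    if "0 \<le> x" "x \<le> y" "y \<le> 1" for x y
    unfolding suminf_mult[OF assms(2)[OF order_trans[OF that(1,2)] that(3)], symmetric]
    by (intro suminf_le gauss_coneD[OF assms(1)] summable_mult assms(2)) (use that in auto)
qed

text \<open>The square expresses contraction by \<open>1 / 2\<close> in the coordinate
  \<open>ln (1 + x)\<close>. The left side is largest for \<open>p = 1\<close>, and
  \<open>c \<ge> 1\<close> bounds \<open>(c + y) / (c + x)\<close> by the right side.\<close>

lemma branch_contraction: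
  fixes c p x y :: real
  assumes "c \<ge> 1" "p \<ge> 1" "0 \<le> x" "x \<le> y"
  shows "((1 + 1 / ((c + x) * p)) / (1 + 1 / ((c + y) * p)))\<^sup>2 \<le> (1 + y) / (1 + x)"
proof -
  define X Y where "X = c + x" and "Y = c + y"
  have X: "1 \<le> X" "X \<le> Y" using assms by (auto simp: X_def Y_def)
  have pos: "0 < X" "0 < Y" "0 < p" using X assms by auto
  have "(1 + 1 / (X * p)) / (1 + 1 / (Y * p)) = ((X * p + 1) * Y) / ((Y * p + 1) * X)"
  proof -
    have "Y * p + 1 > 0" using pos by (simp add: add_pos_pos)
    thus ?thesis using pos by (simp add: divide_simps)
  qed
  also have "\<dots> = 1 + (Y - X) / ((Y * p + 1) * X)"
  proof -
    have "(Y * p + 1) * X > 0" using pos by (simp add: add_pos_pos)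
    thus ?thesis by (simp add: field_simps)
  qed
  also have "\<dots> \<le> 1 + (Y - X) / ((Y + 1) * X)"
    using X assms pos by (intro add_left_mono divide_left_mono mult_right_mono mult_pos_pos add_pos_pos) auto
  also have "\<dots> = ((X + 1) * Y) / ((Y + 1) * X)"
  proof -
    have "(Y + 1) * X > 0" using pos by (simp add: add_pos_pos)
    thus ?thesis by (simp add: field_simps)
  qed
  finally have "(1 + 1 / (X * p)) / (1 + 1 / (Y * p)) \<le> ((X + 1) * Y) / ((Y + 1) * X)" .
  hence "((1 + 1 / (X * p)) / (1 + 1 / (Y * p)))\<^sup>2 \<le> (((X + 1) * Y) / ((Y + 1) * X))\<^sup>2"
    using pos by (intro power_mono) auto
  also have "\<dots> \<le> Y / X"
  proof -
    \<comment> \<open>This product is the difference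
      \<open>(Y + 1)^2 * X - (X + 1)^2 * Y\<close>.\<close>
    have "0 \<le> (Y - X) * (X * Y - 1)"
      using X mult_mono[of 1 X 1 Y] by (intro mult_nonneg_nonneg) auto
    hence "(X + 1)\<^sup>2 * Y \<le> (Y + 1)\<^sup>2 * X"
      by (simp add: power2_eq_square algebra_simps)
    hence "((X + 1)\<^sup>2 * Y) / ((Y + 1)\<^sup>2 * X) \<le> 1" using pos by simp
    hence "((X + 1)\<^sup>2 * Y) / ((Y + 1)\<^sup>2 * X) * (Y / X) \<le> 1 * (Y / X)"
      using pos by (intro mult_right_mono) auto
    moreover have "(((X + 1) * Y) / ((Y + 1) * X))\<^sup>2 = ((X + 1)\<^sup>2 * Y) / ((Y + 1)\<^sup>2 * X) * (Y / X)"
      by (simp add: power2_eq_square mult_ac)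
    ultimately show ?thesis by simp
  qed
  also have "Y / X \<le> (1 + y) / (1 + x)"
  proof -
    have "0 \<le> (c - 1) * (y - x)" using assms by (intro mult_nonneg_nonneg) auto
    thus ?thesis using assms unfolding X_def Y_def by (simp add: field_simps)
  qed
  finally show ?thesis unfolding X_def Y_def .
qed

text \<open>Composition with the branch halves the exponent \<open>6\<close> to \<open>3\<close>,
  and the weight \<open>1 / (c + s)^2\<close> adds \<open>2\<close>. The exponent \<open>6\<close>
  is chosen so that the result \<open>5\<close> leaves one power to spare.\<close>

lemma gauss_cone_branch:
  fixes c p :: real
  assumes g: "gauss_cone 6 g" and cp: "c \<ge> 1" "p \<ge> 1"
  shows "gauss_cone 5 (\<lambda>s. g (1 / ((c + s) * p)) / ((c + s)\<^sup>2 * p))"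
proof -
  have rng: "1 / ((c + s) * p) \<in> {0..1}" if "0 \<le> s" for s
    using that cp mult_mono[of 1 "c + s" 1 p] by auto
  have pos: "0 \<le> g (1 / ((c + s) * p))" if "0 \<le> s" for s
    using gauss_coneD(1)[OF g] rng[OF that] by auto
  have "g (1 / ((c + y) * p)) / ((c + y)\<^sup>2 * p) \<le> ((1 + y) / (1 + x)) ^ 5 * (g (1 / ((c + x) * p)) / ((c + x)\<^sup>2 * p)) \<and>
    g (1 / ((c + x) * p)) / ((c + x)\<^sup>2 * p) \<le> ((1 + y) / (1 + x)) ^ 5 * (g (1 / ((c + y) * p)) / ((c + y)\<^sup>2 * p))"
    if xy: "0 \<le> x" "x \<le> y" "y \<le> 1" for x y
  proof -
    define u v r where "u = 1 / ((c + x) * p)" and "v = 1 / ((c + y) * p)" and "r = (1 + y) / (1 + x)"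
    have uv: "0 \<le> v" "v \<le> u" "u \<le> 1"
      using rng[of x] rng[of y] xy cp by (auto simp: u_def v_def intro!: divide_left_mono)
    have r: "1 \<le> r" using xy by (auto simp: r_def)
    have pos: "0 \<le> g u" "0 \<le> g v" using pos[of x] pos[of y] xy by (auto simp: u_def v_def)
    have "(((1 + u) / (1 + v))\<^sup>2) ^ 3 \<le> r ^ 3"
      unfolding u_def v_def r_def by (intro power_mono branch_contraction) (use xy cp in auto)
    hence R: "((1 + u) / (1 + v)) ^ 6 \<le> r ^ 3" by (simp add: power_mult[symmetric])
    have 1: "g u \<le> r ^ 3 * g v"
      using gauss_coneD(2)[OF g uv] mult_right_mono[OF R pos(2)] by linarith
    have 2: "g v \<le> r ^ 3 * g u"
      using gauss_coneD(3)[OF g uv] mult_right_mono[OF R pos(1)] by linarith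
    have "(c + y) / (c + x) \<le> r"
    proof -
      have "0 \<le> (c - 1) * (y - x)" using cp xy by (intro mult_nonneg_nonneg) auto
      thus ?thesis using cp xy unfolding r_def by (simp add: field_simps)
    qed
    hence "((c + y) / (c + x))\<^sup>2 \<le> r\<^sup>2" using cp xy by (intro power_mono) auto
    hence "(c + y)\<^sup>2 \<le> r\<^sup>2 * (c + x)\<^sup>2" using cp xy by (simp add: power_divide divide_simps)
    hence w: "1 / ((c + x)\<^sup>2 * p) \<le> r\<^sup>2 * (1 / ((c + y)\<^sup>2 * p))"
      using cp xy by (simp add: divide_simps)
    \<comment> \<open>The weight decreases in \<open>s\<close>, so in this direction
      \<open>r ^ 3\<close> already suffices.\<close>
    have "r ^ 3 * g u \<le> r ^ 5 * g u"
      using r pos by (intro mult_right_mono power_increasing) auto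
    hence "g v * (1 / ((c + y)\<^sup>2 * p)) \<le> (r ^ 5 * g u) * (1 / ((c + x)\<^sup>2 * p))"
      using 2 cp xy r pos by (intro mult_mono divide_left_mono mult_right_mono power_mono) auto
    hence A: "g v / ((c + y)\<^sup>2 * p) \<le> r ^ 5 * (g u / ((c + x)\<^sup>2 * p))" by simp
    have "g u * (1 / ((c + x)\<^sup>2 * p)) \<le> (r ^ 3 * g v) * (r\<^sup>2 * (1 / ((c + y)\<^sup>2 * p)))"
      using 1 w cp xy r pos by (intro mult_mono) auto
    also have "\<dots> = r ^ 5 * (g v / ((c + y)\<^sup>2 * p))"
      by (simp add: power_numeral_reduce)
    finally have "g u / ((c + x)\<^sup>2 * p) \<le> r ^ 5 * (g v / ((c + y)\<^sup>2 * p))" by simp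
    with A show ?thesis unfolding u_def v_def r_def by blast
  qed
  thus ?thesis using pos cp by (intro gauss_coneI) auto
qed

text \<open>This spends the spare power. In the worst case \<open>h1 = h2 / r^2\<close>, the claim
  becomes \<open>e * h2 * (r ^ 8 - 1) \<le> g2 * (r - 1) * r ^ 7\<close>. The roles of the two
  points are symmetric, so \<open>key\<close> yields both cone inequalities.\<close>

lemma gauss_cone_diff:
  assumes g: "gauss_cone 5 g" and h: "gauss_cone 2 h" and "e \<ge> 0"
    and small: "\<And>x. 0 \<le> x \<Longrightarrow> x \<le> 1 \<Longrightarrow> 8 * (e * h x) \<le> g x"
  shows "gauss_cone 6 (\<lambda>s. g s - e * h s)"
proof -
  have key: "g1 - e * h1 \<le> r ^ 6 * (g2 - e * h2)"
    if "1 \<le> r" "g1 \<le> r ^ 5 * g2" "h2 \<le> r\<^sup>2 * h1" "8 * (e * h2) \<le> g2" "0 \<le> h2"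
    for g1 g2 h1 h2 r :: real
  proof -
    \<comment> \<open>The factor \<open>8\<close> in the smallness hypothesis counts the terms of
      this geometric sum, each at most \<open>r ^ 7\<close>.\<close>
    have "r ^ 8 - 1 = (r - 1) * (\<Sum>i<8. r ^ i)"
      by (rule power_diff_1_eq)
    also have "\<dots> \<le> (r - 1) * (\<Sum>i<8::nat. r ^ 7)"
      using that(1) by (intro mult_left_mono sum_mono power_increasing) auto
    finally have "(e * h2) * (r ^ 8 - 1) \<le> (e * h2) * ((r - 1) * (8 * r ^ 7))"
      using that(5) \<open>e \<ge> 0\<close> by (intro mult_left_mono) auto
    also have "\<dots> = (8 * (e * h2)) * ((r - 1) * r ^ 7)" by simp
    also have "\<dots> \<le> g2 * ((r - 1) * r ^ 7)"
      using that(1,4) by (intro mult_right_mono) auto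
    finally have A: "(e * h2) * (r ^ 8 - 1) \<le> g2 * ((r - 1) * r ^ 7)" .
    have "r\<^sup>2 * (g1 - e * h1) = r\<^sup>2 * g1 - e * (r\<^sup>2 * h1)" by (simp add: algebra_simps)
    also have "\<dots> \<le> r\<^sup>2 * (r ^ 5 * g2) - e * h2"
      using that \<open>e \<ge> 0\<close> by (intro diff_mono mult_left_mono) auto
    also have "\<dots> \<le> r ^ 8 * (g2 - e * h2)"
      using A by (simp add: algebra_simps power_numeral_reduce)
    also have "\<dots> = r\<^sup>2 * (r ^ 6 * (g2 - e * h2))" by (simp add: power_numeral_reduce)
    finally show ?thesis
      by (rule mult_left_le_imp_le) (use that(1) in simp)
  qed
  show ?thesis
  proof (rule gauss_coneI)
    show "0 \<le> g x - e * h x" if "0 \<le> x" "x \<le> 1" for x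
      using small[OF that] mult_nonneg_nonneg[OF \<open>e \<ge> 0\<close> gauss_coneD(1)[OF h that]] by linarith
  qed (rule key; use gauss_coneD[OF g] gauss_coneD[OF h] small in \<open>auto\<close>)+
qed

section \<open>The transfer operator\<close>

text \<open>This replaces integration: over \<open>[0, 1]\<close> it gives a point where the density
  equals the total mass. Derivatives are taken within \<open>[0, 1]\<close>, so they are one-sided
  at the ends.\<close>

lemma mvt_within:
  fixes G g :: "real \<Rightarrow> real"
  assumes "\<And>s. s \<in> {0..1} \<Longrightarrow> (G has_real_derivative g s) (at s within {0..1})"
    and "0 \<le> u" "u \<le> v" "v \<le> 1"
  obtains z where "z \<in> {0..1}" "G v - G u = (v - u) * g z"
proof -
  have "\<exists>x\<in>{u..v}. G v - G u = (\<lambda>t. g x * t) (v - u)"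
  proof (rule mvt_very_simple[OF assms(3)])
    fix x assume "u \<le> x" "x \<le> v"
    hence "(G has_real_derivative g x) (at x within {u..v})"
      using assms by (intro has_field_derivative_subset[OF assms(1)]) auto
    thus "(G has_derivative (\<lambda>t. g x * t)) (at x within {u..v})"
      by (simp add: has_field_derivative_def)
  qed
  then obtain x where x: "x \<in> {u..v}" "G v - G u = g x * (v - u)" by blast
  show ?thesis
    by (rule that[of x]) (use x assms in \<open>auto simp: mult.commute[of _ "g x"]\<close>)
qed

text \<open>
  If \<open>G\<close> is the distribution function of a random point \<open>x\<close> of \<open>[0, 1]\<close>, then \<open>branch_mass\<close> is the
  probability that \<open>1 / x\<close> has first exponent \<open>a\<close> and that the next point is below \<open>s\<close>.
\<close>

definition branch_mass :: "nat \<Rightarrow> (real \<Rightarrow> real) \<Rightarrow> nat \<Rightarrow> real \<Rightarrow> real" where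
  "branch_mass b G a s = (\<Sum>c=1..<b. G (1 / (real c * real b ^ a)) - G (1 / ((real c + s) * real b ^ a)))"

text \<open>The inverse branch has derivative \<open>- 1 / ((c + s)^2 * b ^ a)\<close>, whose sign
  cancels the minus in \<open>branch_mass\<close>. Summed over \<open>a\<close>, these derivatives
  form the transfer operator applied to \<open>g\<close>.\<close>

lemma branch_mass_has_derivative:
  assumes "b \<ge> 2" "s \<in> {0..1}"
    and G: "\<And>s. s \<in> {0..1} \<Longrightarrow> (G has_real_derivative g s) (at s within {0..1})"
  shows "(branch_mass b G a has_real_derivative
    (\<Sum>c=1..<b. g (1 / ((real c + s) * real b ^ a)) / ((real c + s)\<^sup>2 * real b ^ a))) (at s within {0..1})"
proof -
  have "((\<lambda>s. G (1 / (real c * real b ^ a)) - G (1 / ((real c + s) * real b ^ a))) has_real_derivative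
      g (1 / ((real c + s) * real b ^ a)) / ((real c + s)\<^sup>2 * real b ^ a)) (at s within {0..1})"
    if c: "c \<in> {1..<b}" for c
  proof -
    define f where "f = (\<lambda>s. 1 / ((real c + s) * real b ^ a))"
    have f01: "f t \<in> {0..1}" if "t \<in> {0..1}" for t
      using mult_mono[of 1 "real c + t" 1 "real b ^ a"] assms(1) c that by (auto simp: f_def)
    have pos: "real c + s > 0" "real b ^ a > 0" using assms c by auto
    have f: "(f has_real_derivative - (1 / ((real c + s)\<^sup>2 * real b ^ a))) (at s within {0..1})"
    proof -
      have "((\<lambda>s. (real c + s) * real b ^ a) has_real_derivative real b ^ a) (at s within {0..1})"
        using DERIV_cmult_right[OF DERIV_add[OF DERIV_const[of "real c"] DERIV_ident]] by simp
      from DERIV_inverse'[OF this] pos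
      have "((\<lambda>s. inverse ((real c + s) * real b ^ a)) has_real_derivative
        - (inverse ((real c + s) * real b ^ a) * real b ^ a * inverse ((real c + s) * real b ^ a)))
        (at s within {0..1})" by simp
      moreover have "inverse ((real c + s) * real b ^ a) * real b ^ a * inverse ((real c + s) * real b ^ a)
        = 1 / ((real c + s)\<^sup>2 * real b ^ a)"
      proof -
        have "inverse (w * p) * p * inverse (w * p) = 1 / (w\<^sup>2 * p)" if "w > 0" "p > 0" for w p :: real
          using that by (simp add: power2_eq_square divide_simps)
        from this[OF pos] show ?thesis .
      qed
      ultimately show ?thesis unfolding f_def by (simp only: inverse_eq_divide)
    qed
    have "(G has_real_derivative g (f s)) (at (f s) within f ` {0..1})"
      by (rule has_field_derivative_subset[OF G[OF f01[OF assms(2)]]]) (use f01 in blast)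
    from DERIV_image_chain[OF this f]
    have "((G \<circ> f) has_real_derivative g (f s) * - (1 / ((real c + s)\<^sup>2 * real b ^ a))) (at s within {0..1})" .
    from DERIV_diff[OF DERIV_const[of "G (1 / (real c * real b ^ a))"] this]
    show ?thesis unfolding f_def o_def by simp
  qed
  thus ?thesis unfolding branch_mass_def by (intro DERIV_sum) auto
qed

text \<open>The series is differentiated term by term, justified by the Weierstrass test. Each term
  of the derivative lies in the cone of exponent \<open>5\<close>, hence so does the sum.\<close>

lemma transfer_cone:
  assumes b: "b \<ge> 2" and g: "gauss_cone 6 g"
    and G: "\<And>s. s \<in> {0..1} \<Longrightarrow> (G has_real_derivative g s) (at s within {0..1})"
    and G1: "\<And>s. s \<in> {0..1} \<Longrightarrow> (\<lambda>a. branch_mass b G a s) sums G1 s"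
  obtains g1 where "gauss_cone 5 g1"
    "\<And>s. s \<in> {0..1} \<Longrightarrow> (G1 has_real_derivative g1 s) (at s within {0..1})"
proof -
  define d where "d = (\<lambda>a s. \<Sum>c=1..<b. g (1 / ((real c + s) * real b ^ a)) / ((real c + s)\<^sup>2 * real b ^ a))"
  have p: "real b ^ a \<ge> 1" for a using b by simp
  have d_cone: "gauss_cone 5 (d a)" for a
    unfolding d_def by (intro gauss_cone_sum gauss_cone_branch g p) auto
  \<comment> \<open>There are \<open>b - 1\<close> digits \<open>c\<close>; each contributes a value
    of \<open>g\<close> of at most \<open>2 ^ 6 * g 0\<close> and a weight of at most
    \<open>1 / b ^ a\<close>.\<close>
  define K where "K = (real b - 1) * (2 ^ 6 * g 0)"
  have d_le: "d a s \<le> K * (1 / real b) ^ a" if s: "s \<in> {0..1}" for a s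
  proof -
    have "d a s \<le> (\<Sum>c=1..<b. (2 ^ 6 * g 0) / real b ^ a)"
      unfolding d_def
    proof (intro sum_mono frac_le)
      fix c assume c: "c \<in> {1..<b}"
      have "1 * 1 \<le> (real c + s) * real b ^ a" using c s p[of a] by (intro mult_mono) auto
      hence "1 / ((real c + s) * real b ^ a) \<in> {0..1}" by auto
      thus "g (1 / ((real c + s) * real b ^ a)) \<le> 2 ^ 6 * g 0"
        by (intro gauss_cone_bound[OF g]) auto
      have "1 \<le> (real c + s)\<^sup>2" using c s by (intro one_le_power) auto
      thus "real b ^ a \<le> (real c + s)\<^sup>2 * real b ^ a"
        using p[of a] by (intro mult_le_cancel_right1[THEN iffD2]) auto
    qed (use b gauss_coneD(1)[OF g, of 0] in auto)
    also have "\<dots> = K * (1 / real b) ^ a"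
      using b by (simp add: K_def power_one_over of_nat_diff field_simps)
    finally show ?thesis .
  qed
  have M: "summable (\<lambda>a. K * (1 / real b) ^ a)"
    using b by (intro summable_mult summable_geometric) auto
  have norm_d: "norm (d a s) \<le> K * (1 / real b) ^ a" if "s \<in> {0..1}" for a s
    using d_le[OF that] gauss_coneD(1)[OF d_cone] that by auto
  have "\<exists>F. \<forall>x\<in>{0..1}. (\<lambda>a. branch_mass b G a x) sums F x \<and>
      (F has_field_derivative (\<Sum>a. d a x)) (at x within {0..1})"
  proof (rule has_field_derivative_series)
    show "(branch_mass b G a has_real_derivative d a x) (at x within {0..1})" if "x \<in> {0..1}" for a x
      unfolding d_def by (rule branch_mass_has_derivative[OF b that G])
    show "uniform_limit {0..1} (\<lambda>n x. \<Sum>i<n. d i x) (\<lambda>x. \<Sum>a. d a x) sequentially"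
      by (rule Weierstrass_m_test[OF norm_d M])
    \<comment> \<open>Convergence is needed at one point only; at \<open>0\<close> all terms
      vanish.\<close>
    show "summable (\<lambda>n. branch_mass b G n 0)" by (simp add: branch_mass_def)
  qed auto
  then obtain F where F: "\<And>x. x \<in> {0..1} \<Longrightarrow> (\<lambda>a. branch_mass b G a x) sums F x"
    "\<And>x. x \<in> {0..1} \<Longrightarrow> (F has_field_derivative (\<Sum>a. d a x)) (at x within {0..1})"
    by blast
  show ?thesis
  proof (rule that[of "\<lambda>s. \<Sum>a. d a s"])
    show "gauss_cone 5 (\<lambda>s. \<Sum>a. d a s)"
      using norm_d by (intro gauss_cone_suminf d_cone summable_comparison_test'[OF M]) auto
    show "(G1 has_real_derivative (\<Sum>a. d a s)) (at s within {0..1})" if "s \<in> {0..1}" for s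
      by (rule has_field_derivative_transform_within[OF F(2)[OF that] zero_less_one that])
         (use sums_unique2[OF F(1) G1] in auto)
  qed
qed

text \<open>At \<open>s = 1\<close> the sum over \<open>c\<close> telescopes to
  \<open>G (1 / b ^ a) - G (1 / b ^ Suc a)\<close>, and the series over \<open>a\<close> then
  telescopes to \<open>G 1 - G 0\<close> by continuity of \<open>G\<close> at
  \<open>0\<close>.\<close>

lemma transfer_mass:
  assumes b: "b \<ge> 2"
    and G: "\<And>s. s \<in> {0..1} \<Longrightarrow> (G has_real_derivative g s) (at s within {0..1})"
    and G1: "\<And>s. s \<in> {0..1} \<Longrightarrow> (\<lambda>a. branch_mass b G a s) sums G1 s"
  shows "G1 1 - G1 0 = G 1 - G 0"
proof -
  have "(\<lambda>a. branch_mass b G a 0) sums 0" by (simp add: branch_mass_def)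
  hence G10: "G1 0 = 0" using G1[of 0] sums_unique2 by auto
  define D where "D = (\<lambda>a. G (1 / real b ^ a))"
  have m: "branch_mass b G a 1 = D a - D (Suc a)" for a
  proof -
    have "branch_mass b G a 1 = - (\<Sum>c=1..<b. G (1 / (real (Suc c) * real b ^ a)) - G (1 / (real c * real b ^ a)))"
      unfolding branch_mass_def sum_negf[symmetric] by (intro sum.cong) (auto simp: algebra_simps)
    also have "\<dots> = D a - D (Suc a)"
      by (subst sum_Suc_diff') (use b in \<open>auto simp: D_def\<close>)
    finally show ?thesis .
  qed
  have "(\<lambda>a. (1 / real b) ^ a) \<longlonglongrightarrow> 0" using b by (intro LIMSEQ_power_zero) auto
  hence lim: "(\<lambda>a. 1 / real b ^ a) \<longlonglongrightarrow> 0" by (simp add: power_one_over)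
  have "continuous_on {0..1} G"
    using G by (intro continuous_on_eq_continuous_within[THEN iffD2]) (blast intro: DERIV_continuous)
  hence "D \<longlonglongrightarrow> G 0"
    unfolding D_def by (rule continuous_on_tendsto_compose[OF _ lim]) (use b in auto)
  hence "(\<lambda>a. D a - D (Suc a)) sums (D 0 - G 0)" by (rule telescope_sums')
  hence "G1 1 = D 0 - G 0" using G1[of 1] sums_unique2 by (auto simp: m)
  thus ?thesis using G10 by (simp add: D_def)
qed

section \<open>The invariant distribution\<close>

text \<open>The analogue of Gauss's distribution function \<open>log 2 (1 + s)\<close> for continued
  fractions. The denominator is the numerator at \<open>s = 1\<close>.\<close>

definition gauss_df :: "nat \<Rightarrow> real \<Rightarrow> real" where
  "gauss_df b s = ln (real b * (1 + s) / (real b + s)) / ln (2 * real b / (real b + 1))"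

definition gauss_density :: "nat \<Rightarrow> real \<Rightarrow> real" where
  "gauss_density b s = (real b - 1) / ((1 + s) * (real b + s) * ln (2 * real b / (real b + 1)))"

lemma gauss_norm_pos: "b \<ge> 2 \<Longrightarrow> ln (2 * real b / (real b + 1)) > 0"
  by (intro ln_gt_zero) (auto simp: field_simps)

lemma gauss_df_has_derivative:
  assumes "b \<ge> 2" "s \<ge> 0"
  shows "(gauss_df b has_real_derivative gauss_density b s) (at s within S)"
proof -
  have pos: "real b + s > 0" "1 + s > 0" "real b > 0" using assms by auto
  have "((\<lambda>s. ln (real b * (1 + s) / (real b + s))) has_real_derivative
      (real b - 1) / ((1 + s) * (real b + s))) (at s within S)"
  proof -
    have "((\<lambda>s. real b * (1 + s) / (real b + s)) has_real_derivative
        (real b * (real b + s) - real b * (1 + s) * 1) / ((real b + s) * (real b + s))) (at s within S)"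
      by (rule DERIV_divide) (use pos in \<open>auto intro!: derivative_eq_intros\<close>)
    from DERIV_chain2[OF DERIV_ln_divide this] pos
    have "((\<lambda>s. ln (real b * (1 + s) / (real b + s))) has_real_derivative
        1 / (real b * (1 + s) / (real b + s)) *
        ((real b * (real b + s) - real b * (1 + s) * 1) / ((real b + s) * (real b + s)))) (at s within S)"
      by simp
    also have "1 / (real b * (1 + s) / (real b + s)) *
        ((real b * (real b + s) - real b * (1 + s) * 1) / ((real b + s) * (real b + s)))
        = (real b - 1) / ((1 + s) * (real b + s))"
      using pos by (simp add: divide_simps) (simp add: algebra_simps)
    finally show ?thesis .
  qed
  from DERIV_cdivide[OF this, of "ln (2 * real b / (real b + 1))"]
  show ?thesis by (simp add: gauss_df_def[abs_def] gauss_density_def)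
qed

lemma gauss_df_0: "b \<ge> 2 \<Longrightarrow> gauss_df b 0 = 0"
  and gauss_df_1: "b \<ge> 2 \<Longrightarrow> gauss_df b 1 = 1"
  using gauss_norm_pos[of b] by (auto simp: gauss_df_def mult.commute)

text \<open>The density decreases, which gives one inequality. For the other, the factors
  \<open>1 / (1 + s)\<close> and \<open>1 / (b + s)\<close> cost one power each, the latter because
  \<open>b \<ge> 1\<close>.\<close>

lemma gauss_cone_density:
  assumes "b \<ge> 2"
  shows "gauss_cone 2 (gauss_density b)"
proof -
  define C where "C = (real b - 1) / ln (2 * real b / (real b + 1))"
  have C: "C \<ge> 0" using gauss_norm_pos[OF assms] assms by (auto simp: C_def)
  have h: "gauss_density b s = C * (1 / ((1 + s) * (real b + s)))" for s
    by (simp add: gauss_density_def C_def field_simps)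
  have B: "real b \<ge> 2" using assms by simp
  show ?thesis
  proof (rule gauss_coneI)
    fix x :: real assume "0 \<le> x" "x \<le> 1"
    thus "0 \<le> gauss_density b x" unfolding h using C by auto
  next
    fix x y :: real assume xy: "0 \<le> x" "x \<le> y" "y \<le> 1"
    have "1 / ((1 + y) * (real b + y)) \<le> 1 / ((1 + x) * (real b + x))"
      using xy B by (intro divide_left_mono mult_mono mult_pos_pos) auto
    also have "\<dots> = 1 * \<dots>" by simp
    also have "\<dots> \<le> ((1 + y) / (1 + x))\<^sup>2 * (1 / ((1 + x) * (real b + x)))"
      using xy B by (intro mult_right_mono one_le_power) auto
    finally show "gauss_density b y \<le> ((1 + y) / (1 + x))\<^sup>2 * gauss_density b x"
      unfolding h mult.left_commute[of _ C] by (rule mult_left_mono[OF _ C])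
  next
    fix x y :: real assume xy: "0 \<le> x" "x \<le> y" "y \<le> 1"
    have "0 \<le> (real b - 1) * (y - x)" using xy B by (intro mult_nonneg_nonneg) auto
    hence "(1 + x) * (real b + y) \<le> (1 + y) * (real b + x)" by (simp add: algebra_simps)
    hence "1 / (real b + x) \<le> ((1 + y) / (1 + x)) * (1 / (real b + y))"
      using xy B by (simp add: divide_simps)
    hence "1 / (1 + x) * (1 / (real b + x)) \<le> 1 / (1 + x) * (((1 + y) / (1 + x)) * (1 / (real b + y)))"
      using xy by (intro mult_left_mono) auto
    also have "\<dots> = ((1 + y) / (1 + x))\<^sup>2 * (1 / ((1 + y) * (real b + y)))"
      using xy B by (simp add: power2_eq_square)
    finally have "1 / ((1 + x) * (real b + x))
        \<le> ((1 + y) / (1 + x))\<^sup>2 * (1 / ((1 + y) * (real b + y)))" by simp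
    thus "gauss_density b x \<le> ((1 + y) / (1 + x))\<^sup>2 * gauss_density b y"
      unfolding h mult.left_commute[of _ C] by (rule mult_left_mono[OF _ C])
  qed
qed

text \<open>The density takes its mean value \<open>1\<close> somewhere, and the cone bound with
  exponent \<open>2\<close> gives the factor \<open>4\<close>.\<close>

lemma gauss_density_le:
  assumes "b \<ge> 2" "x \<in> {0..1}"
  shows "gauss_density b x \<le> 4"
proof -
  obtain z where z: "z \<in> {0..1}" "gauss_df b 1 - gauss_df b 0 = (1 - 0) * gauss_density b z"
    by (rule mvt_within[of "gauss_df b" "gauss_density b" 0 1])
       (use gauss_df_has_derivative[OF assms(1)] in auto)
  thus ?thesis
    using gauss_cone_bound[OF gauss_cone_density[OF assms(1)] assms(2) z(1)]
    by (simp add: gauss_df_0 gauss_df_1 assms)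
qed

text \<open>For \<open>u = l * b ^ k\<close> and \<open>v = (l + 1) * b ^ k\<close> this is the
  limit value in the theorem. The same formula exposes the telescoping in
  \<open>gauss_df_invariant\<close>.\<close>

lemma gauss_df_inverse_diff:
  assumes "b \<ge> 2" "u > 0" "v > 0"
  shows "gauss_df b (1 / u) - gauss_df b (1 / v)
    = ln (((u + 1) * (real b * v + 1)) / ((real b * u + 1) * (v + 1))) / ln (2 * real b / (real b + 1))"
proof -
  have pos: "u + 1 > 0" "v + 1 > 0" "real b * u + 1 > 0" "real b * v + 1 > 0" "real b > 0"
    using assms by (auto intro: add_pos_pos)
  have e: "real b * (1 + 1 / w) / (real b + 1 / w) = real b * (w + 1) / (real b * w + 1)"
    if "w > 0" for w
    using that pos by (simp add: divide_simps)
  have "ln (real b * (u + 1) / (real b * u + 1)) - ln (real b * (v + 1) / (real b * v + 1))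
    = ln (((u + 1) * (real b * v + 1)) / ((real b * u + 1) * (v + 1)))"
    using pos by (simp add: ln_div ln_mult)
  thus ?thesis
    unfolding gauss_df_def e[OF assms(2)] e[OF assms(3)] by (simp add: diff_divide_distrib[symmetric])
qed

text \<open>Two telescoping sums: for fixed \<open>c\<close> the series over \<open>a\<close>
  collapses to logarithms in \<open>c\<close> and \<open>c + s\<close>, and these then collapse in
  the sum over \<open>c\<close>.\<close>

lemma gauss_df_invariant:
  assumes b: "b \<ge> 2" and s: "s \<in> {0..1}"
  shows "(\<lambda>a. branch_mass b (gauss_df b) a s) sums gauss_df b s"
proof -
  define N where "N = ln (2 * real b / (real b + 1))"
  have B: "real b \<ge> 2" using b by simp
  have *: "(\<lambda>a. gauss_df b (1 / (real c * real b ^ a)) - gauss_df b (1 / ((real c + s) * real b ^ a)))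
      sums ((ln ((real c + 1) / real c) - ln ((real c + s + 1) / (real c + s))) / N)"
    if c: "c \<in> {1..<b}" for c
  proof -
    define u v where "u = real c" and "v = real c + s"
    have uv: "u > 0" "v > 0" using c s by (auto simp: u_def v_def)
    define D where "D = (\<lambda>a. ln ((1 + u * real b ^ a) / (1 + v * real b ^ a)))"
    have pos: "u * real b ^ a > 0" "v * real b ^ a > 0" for a using uv b by auto
    have step: "gauss_df b (1 / (u * real b ^ a)) - gauss_df b (1 / (v * real b ^ a)) = (D a - D (Suc a)) / N" for a
    proof -
      have "1 + u * real b ^ a > 0" "1 + v * real b ^ a > 0"
        "1 + u * real b ^ Suc a > 0" "1 + v * real b ^ Suc a > 0"
        using pos[of a] pos[of "Suc a"] by linarith+
      hence "D a - D (Suc a) = ln (((u * real b ^ a + 1) * (real b * (v * real b ^ a) + 1)) /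
          ((real b * (u * real b ^ a) + 1) * (v * real b ^ a + 1)))"
        unfolding D_def by (simp add: ln_div ln_mult add.commute mult.left_commute)
      thus ?thesis using gauss_df_inverse_diff[OF b pos[of a]] by (simp add: N_def)
    qed
    have L: "(\<lambda>a. (1 / real b) ^ a) \<longlonglongrightarrow> 0" using b by (intro LIMSEQ_power_zero) auto
    \<comment> \<open>Cancelling \<open>b ^ a\<close> in the argument of the logarithm in
      \<open>D\<close> shows its limit \<open>u / v\<close>.\<close>
    have "(\<lambda>a. ((1 / real b) ^ a + u) / ((1 / real b) ^ a + v)) \<longlonglongrightarrow> (0 + u) / (0 + v)"
      using uv by (intro tendsto_divide tendsto_add tendsto_const L) auto
    also have "(\<lambda>a. ((1 / real b) ^ a + u) / ((1 / real b) ^ a + v)) =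
        (\<lambda>a. (1 + u * real b ^ a) / (1 + v * real b ^ a))"
    proof
      fix a
      have "real b ^ a > 0" "1 + v * real b ^ a > 0" using pos[of a] b by (auto intro: add_pos_pos)
      thus "((1 / real b) ^ a + u) / ((1 / real b) ^ a + v) = (1 + u * real b ^ a) / (1 + v * real b ^ a)"
        using b by (simp add: power_one_over divide_simps)
    qed
    finally have "D \<longlonglongrightarrow> ln (u / v)"
      unfolding D_def using uv by (intro tendsto_ln) auto
    hence "(\<lambda>a. (D a - D (Suc a)) / N) sums ((D 0 - ln (u / v)) / N)"
      by (intro sums_divide telescope_sums')
    moreover have "D 0 - ln (u / v) = ln ((u + 1) / u) - ln ((v + 1) / v)"
      using uv by (simp add: D_def ln_div add.commute)
    ultimately show ?thesis using step by (simp add: u_def v_def)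
  qed
  have "(\<Sum>c=1..<b. (ln ((real c + 1) / real c) - ln ((real c + s + 1) / (real c + s))) / N)
      = (\<Sum>c=1..<b. ln (real (Suc c) / (real (Suc c) + s)) - ln (real c / (real c + s))) / N"
    unfolding sum_divide_distrib
    using s by (intro sum.cong arg_cong[where f = "\<lambda>x. x / N"]) (auto simp: ln_div add_ac)
  also have "\<dots> = (ln (real b / (real b + s)) - ln (1 / (1 + s))) / N"
    by (subst sum_Suc_diff') (use b in auto)
  also have "\<dots> = gauss_df b s"
    using s B unfolding gauss_df_def N_def by (simp add: ln_div ln_mult)
  finally have sum_eq: "(\<Sum>c=1..<b. (ln ((real c + 1) / real c) - ln ((real c + s + 1) / (real c + s))) / N)
      = gauss_df b s" .
  show ?thesis
    unfolding branch_mass_def sum_eq[symmetric] by (rule sums_sum) (rule *)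
qed

section \<open>Exponential convergence\<close>

text \<open>By induction, \<open>F m\<close> is \<open>1 - q ^ m\<close> times the invariant
  distribution plus a remainder whose density lies in the cone. Since \<open>F m\<close> has total
  mass \<open>1\<close>, the remainder has mass \<open>q ^ m\<close>.\<close>

lemma transfer_decay:
  fixes F :: "nat \<Rightarrow> real \<Rightarrow> real"
  assumes b: "b \<ge> 2"
    and F0: "\<And>s. s \<in> {0..1} \<Longrightarrow> F 0 s = s"
    and FS: "\<And>m s. s \<in> {0..1} \<Longrightarrow> (\<lambda>a. branch_mass b (F m) a s) sums F (Suc m) s"
  defines "q \<equiv> 1023 / 1024"
  shows "\<exists>g. gauss_cone 6 g \<and>
    (\<forall>s\<in>{0..1}. ((\<lambda>s. F m s - (1 - q ^ m) * gauss_df b s) has_real_derivative g s) (at s within {0..1})) \<and>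
    F m 1 - F m 0 = 1"
proof (induction m)
  case 0
  have "gauss_cone 6 (\<lambda>_. 1)" by (rule gauss_coneI) (auto intro!: one_le_power)
  moreover have "(F 0 has_real_derivative 1) (at s within {0..1})" if "s \<in> {0..1}" for s
    by (rule has_field_derivative_transform_within[OF DERIV_ident zero_less_one that]) (use F0 in auto)
  ultimately show ?case using F0 by auto
next
  case (Suc m)
  define G where "G = (\<lambda>s. F m s - (1 - q ^ m) * gauss_df b s)"
  define G1 where "G1 = (\<lambda>s. F (Suc m) s - (1 - q ^ m) * gauss_df b s)"
  from Suc obtain g where g: "gauss_cone 6 g"
    and G: "\<And>s. s \<in> {0..1} \<Longrightarrow> (G has_real_derivative g s) (at s within {0..1})"
    and mass: "F m 1 - F m 0 = 1"
    unfolding G_def by blast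
  have lin: "branch_mass b G a s = branch_mass b (F m) a s - (1 - q ^ m) * branch_mass b (gauss_df b) a s" for a s
    unfolding branch_mass_def G_def sum_distrib_left sum_subtractf[symmetric]
    by (intro sum.cong) (auto simp: algebra_simps)
  have G1: "(\<lambda>a. branch_mass b G a s) sums G1 s" if "s \<in> {0..1}" for s
    unfolding lin G1_def by (intro sums_diff sums_mult FS gauss_df_invariant b that)
  obtain g1 where g1: "gauss_cone 5 g1"
    and dG1: "\<And>s. s \<in> {0..1} \<Longrightarrow> (G1 has_real_derivative g1 s) (at s within {0..1})"
    using transfer_cone[OF b g G G1] by blast
  have "G 1 - G 0 = q ^ m" using mass by (simp add: G_def gauss_df_0 gauss_df_1 b)
  hence mass1: "G1 1 - G1 0 = q ^ m" using transfer_mass[OF b G G1] by simp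
  \<comment> \<open>The denominator is \<open>8 * 4 * 32\<close>: the factor of
    \<open>gauss_cone_diff\<close>, the bound on the invariant density, and the cone constant
    \<open>2 ^ 5\<close> for \<open>g1\<close>. Subtracting \<open>e\<close> times the invariant
    density leaves mass \<open>q ^ m - e = q ^ Suc m\<close>.\<close>
  define e where "e = q ^ m / 1024"
  have e: "e \<ge> 0" by (simp add: e_def q_def)
  obtain z where "z \<in> {0..1}" "G1 1 - G1 0 = (1 - 0) * g1 z"
    using mvt_within[OF dG1 order_refl zero_le_one order_refl] by blast
  hence z: "z \<in> {0..1}" "g1 z = q ^ m" using mass1 by simp_all
  have "8 * (e * gauss_density b x) \<le> g1 x" if "0 \<le> x" "x \<le> 1" for x
  proof -
    have "e * gauss_density b x \<le> e * 4"
      using gauss_density_le[OF b, of x] that e by (intro mult_left_mono) auto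
    moreover have "q ^ m \<le> 2 ^ 5 * g1 x"
      using gauss_cone_bound[OF g1 z(1), of x] z(2) that by auto
    ultimately show ?thesis by (simp add: e_def)
  qed
  hence "gauss_cone 6 (\<lambda>s. g1 s - e * gauss_density b s)"
    by (rule gauss_cone_diff[OF g1 gauss_cone_density[OF b] e])
  moreover have "((\<lambda>s. F (Suc m) s - (1 - q ^ Suc m) * gauss_df b s) has_real_derivative
      g1 s - e * gauss_density b s) (at s within {0..1})" if "s \<in> {0..1}" for s
  proof -
    have "((\<lambda>s. G1 s - e * gauss_df b s) has_real_derivative g1 s - e * gauss_density b s) (at s within {0..1})"
      using that by (intro DERIV_diff dG1 DERIV_cmult gauss_df_has_derivative b) auto
    also have "(\<lambda>s. G1 s - e * gauss_df b s) = (\<lambda>s. F (Suc m) s - (1 - q ^ Suc m) * gauss_df b s)"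
      by (auto simp: G1_def e_def q_def algebra_simps)
    finally show ?thesis .
  qed
  moreover have "F (Suc m) 1 - F (Suc m) 0 = 1"
    using mass1 by (simp add: G1_def gauss_df_0 gauss_df_1 b)
  ultimately show ?case by blast
qed

text \<open>The error is the remainder minus \<open>(1023 / 1024) ^ m\<close> times the invariant
  distribution. Both densities lie between \<open>0\<close> and
  \<open>64 * (1023 / 1024) ^ m\<close>, hence so does the absolute value of their difference; the
  mean value theorem supplies the factor \<open>v - u\<close>.\<close>

lemma transfer_convergence:
  fixes F :: "nat \<Rightarrow> real \<Rightarrow> real"
  assumes b: "b \<ge> 2"
    and F0: "\<And>s. s \<in> {0..1} \<Longrightarrow> F 0 s = s"
    and FS: "\<And>m s. s \<in> {0..1} \<Longrightarrow> (\<lambda>a. branch_mass b (F m) a s) sums F (Suc m) s"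
    and uv: "0 \<le> u" "u \<le> v" "v \<le> 1"
  shows "\<bar>(F m v - F m u) - (gauss_df b v - gauss_df b u)\<bar> \<le> 64 * (1023 / 1024) ^ m * (v - u)"
proof -
  \<comment> \<open>Here \<open>q\<close> already includes the power \<open>m\<close>; it is the
    mass of the remainder.\<close>
  define q :: real where "q = (1023 / 1024) ^ m"
  have q: "q > 0" by (simp add: q_def)
  obtain g where g: "gauss_cone 6 g"
    and G: "\<And>s. s \<in> {0..1} \<Longrightarrow>
      ((\<lambda>s. F m s - (1 - q) * gauss_df b s) has_real_derivative g s) (at s within {0..1})"
    and mass: "F m 1 - F m 0 = 1"
    using transfer_decay[OF b F0 FS, of m] unfolding q_def by blast
  obtain z where "z \<in> {0..1}" "(F m 1 - (1 - q) * gauss_df b 1) - (F m 0 - (1 - q) * gauss_df b 0) = (1 - 0) * g z"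
    using mvt_within[OF G order_refl zero_le_one order_refl] by blast
  hence z: "z \<in> {0..1}" "g z = q" using mass by (simp_all add: gauss_df_0 gauss_df_1 b)
  have D: "((\<lambda>s. F m s - (1 - q) * gauss_df b s - q * gauss_df b s) has_real_derivative
      g s - q * gauss_density b s) (at s within {0..1})" if "s \<in> {0..1}" for s
    using that by (intro DERIV_diff[OF G] DERIV_cmult gauss_df_has_derivative b) auto
  obtain w where w: "w \<in> {0..1}" and
    "(F m v - (1 - q) * gauss_df b v - q * gauss_df b v) - (F m u - (1 - q) * gauss_df b u - q * gauss_df b u)
      = (v - u) * (g w - q * gauss_density b w)"
    using mvt_within[OF D uv] by blast
  hence eq: "(F m v - F m u) - (gauss_df b v - gauss_df b u) = (v - u) * (g w - q * gauss_density b w)"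
    by (simp add: algebra_simps)
  have "0 \<le> g w" "g w \<le> 64 * q"
    using gauss_coneD(1)[OF g] gauss_cone_bound[OF g w z(1)] w z(2) by auto
  moreover have "0 \<le> q * gauss_density b w" "q * gauss_density b w \<le> q * 4"
    using gauss_coneD(1)[OF gauss_cone_density[OF b], of w] gauss_density_le[OF b w] w q by auto
  ultimately have "\<bar>g w - q * gauss_density b w\<bar> \<le> 64 * q" using q by linarith
  hence "(v - u) * \<bar>g w - q * gauss_density b w\<bar> \<le> (v - u) * (64 * q)"
    using uv by (intro mult_left_mono) auto
  thus ?thesis unfolding eq q_def using uv by (simp add: abs_mult mult_ac)
qed

section \<open>The error estimate for the digit sets\<close>

theorem theorem20:
  fixes b :: nat
  assumes "b \<ge> 2"
  shows "\<exists>A lam :: real. A > 0 \<and> lam > 0 \<and>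
    (\<forall>k l n :: nat. l \<in> {1..b - 1} \<longrightarrow> n \<ge> 1 \<longrightarrow>
      \<bar>measure lebesgue (clog_D b n k l)
        - ln (((real l * real b ^ k + 1) * ((real l + 1) * real b ^ (k + 1) + 1))
              / ((real l * real b ^ (k + 1) + 1) * ((real l + 1) * real b ^ k + 1)))
          / ln (2 * real b / (real b + 1))\<bar>
      < A * exp (- lam * sqrt (real n - 1)) / (real l * (real l + 1) * real b ^ k))"
proof -
  \<comment> \<open>With this choice \<open>exp (- lam * m)\<close> equals
    \<open>(1023 / 1024) ^ m\<close>.\<close>
  define lam :: real where "lam = - ln (1023 / 1024)"
  have lam: "lam > 0" unfolding lam_def by (simp add: ln_less_zero)
  have "\<bar>measure lebesgue (clog_D b n k l)
        - ln (((real l * real b ^ k + 1) * ((real l + 1) * real b ^ (k + 1) + 1))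
              / ((real l * real b ^ (k + 1) + 1) * ((real l + 1) * real b ^ k + 1)))
          / ln (2 * real b / (real b + 1))\<bar>
      < 65 * exp (- lam * sqrt (real n - 1)) / (real l * (real l + 1) * real b ^ k)"
    if l: "l \<in> {1..b - 1}" and n: "n \<ge> 1" for k l n
  proof -
    obtain m where m: "n = Suc m" using n by (cases n) auto
    have lb: "l \<in> {1..<b}" using l by auto
    define p where "p = real b ^ k"
    define x y where "x = real l * p" and "y = (real l + 1) * p"
    have p: "p > 0" using assms by (simp add: p_def)
    have x: "1 \<le> x" using clog_scale_ge_1[OF assms lb, of 0 k] by (simp add: x_def p_def)
    have xy: "x < y" using p by (simp add: x_def y_def)
    \<comment> \<open>The length of the interval of reciprocals is exactly the denominator demanded
      by the error term.\<close>
    have len: "1 / x - 1 / y = 1 / (real l * (real l + 1) * p)"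
    proof -
      have "1 / x - 1 / y = (y - x) / (x * y)" using x xy by (simp add: field_simps)
      also have "y - x = p * 1" by (simp add: x_def y_def algebra_simps)
      also have "x * y = p * (real l * (real l + 1) * p)" by (simp add: x_def y_def mult_ac)
      also have "p * 1 / (p * (real l * (real l + 1) * p)) = 1 / (real l * (real l + 1) * p)"
        by (rule mult_divide_mult_cancel_left) (use p in simp)
      finally show ?thesis .
    qed
    have "measure lebesgue (clog_D b n k l) = clog_dist b m (1 / x) - clog_dist b m (1 / y)"
      unfolding m x_def y_def p_def by (rule measure_clog_D[OF assms lb])
    moreover have "ln (((real l * real b ^ k + 1) * ((real l + 1) * real b ^ (k + 1) + 1))
              / ((real l * real b ^ (k + 1) + 1) * ((real l + 1) * real b ^ k + 1)))
          / ln (2 * real b / (real b + 1)) = gauss_df b (1 / x) - gauss_df b (1 / y)"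
      using gauss_df_inverse_diff[OF assms, of x y] x xy by (simp add: x_def y_def p_def mult_ac)
    moreover have "\<bar>(clog_dist b m (1 / x) - clog_dist b m (1 / y)) - (gauss_df b (1 / x) - gauss_df b (1 / y))\<bar>
        \<le> 64 * (1023 / 1024) ^ m * (1 / x - 1 / y)"
    proof (rule transfer_convergence[OF assms])
      show "clog_dist b 0 s = s" if "s \<in> {0..1}" for s
        using clog_tail_1[OF assms, of s] that by (simp add: clog_dist_def)
      show "(\<lambda>a. branch_mass b (clog_dist b j) a s) sums clog_dist b (Suc j) s" if "s \<in> {0..1}" for j s
        unfolding branch_mass_def using that by (intro clog_dist_sums assms) auto
    qed (use x xy in \<open>auto intro!: divide_left_mono\<close>)
    ultimately have "\<bar>measure lebesgue (clog_D b n k l)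
        - ln (((real l * real b ^ k + 1) * ((real l + 1) * real b ^ (k + 1) + 1))
              / ((real l * real b ^ (k + 1) + 1) * ((real l + 1) * real b ^ k + 1)))
          / ln (2 * real b / (real b + 1))\<bar> \<le> 64 * (1023 / 1024) ^ m * (1 / x - 1 / y)"
      by presburger
    also have "\<dots> < 65 * exp (- lam * sqrt (real n - 1)) * (1 / x - 1 / y)"
    proof (rule mult_strict_right_mono)
      \<comment> \<open>Geometric decay in \<open>m = n - 1\<close> is stronger than decay in
        \<open>sqrt m\<close>. Passing from \<open>64\<close> to \<open>65\<close> makes the
        inequality strict.\<close>
      have "sqrt (real m) \<le> real m"
        by (cases "m = 0") (auto intro!: real_le_lsqrt simp: power2_eq_square)
      hence "- lam * real m \<le> - lam * sqrt (real m)" using lam by simp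
      moreover have "exp (- lam * real m) = (1023 / 1024) ^ m"
        using exp_of_nat_mult[of m "ln (1023 / 1024 :: real)"] by (simp add: lam_def mult.commute)
      ultimately have "(1023 / 1024) ^ m \<le> exp (- lam * sqrt (real m))"
        by (metis exp_le_cancel_iff)
      moreover have "real n - 1 = real m" by (simp add: m)
      ultimately show "64 * (1023 / 1024) ^ m < 65 * exp (- lam * sqrt (real n - 1))"
        using exp_gt_zero[of "- lam * sqrt (real m)"] by (simp only:)
      show "0 < 1 / x - 1 / y" using x xy by (simp add: divide_strict_left_mono)
    qed
    also have "\<dots> = 65 * exp (- lam * sqrt (real n - 1)) / (real l * (real l + 1) * real b ^ k)"
      unfolding len p_def by simp
    finally show ?thesis .
  qed
  with lam show ?thesis by (intro exI[of _ 65] exI[of _ lam]) auto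
qed

end
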